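(* There exist smooth complex cubic threefolds $X\subset\mathbb{P}^{4}$ that have no Eckardt points but contain triple lines. (In particular, a smooth complex cubic threefold containing triple lines need not contain Eckardt points.)
   Context: A smooth complex cubic threefold is a smooth hypersurface $X\subset\mathbb{P}^{4}=\mathbb{P}^{4}_{\mathbb{C}}$ of degree three. For $p\in X$, let $T_{p}X\subset\mathbb{P}^{4}$ denote the projective tangent space of $X$ at $p$ (a hyperplane). A point $p\in X$ is an Eckardt point if it is a point of multiplicity three of the cubic surface $X\cap T_{p}X\subset T_{p}X$. A line $\ell\subset X$ is of the second type if there exists a unique 2-plane $P\subset\mathbb{P}^{4}$ containing $\ell$ and tangent to $X$ at all points of $\ell$ (i.e. $P\subset T_{x}X$ for every $x\in\ell$); in that case $P\cap X=2\ell\cup\ell'$ as a plane cubic curve, where the line $\ell'$ is called the residual line of $\ell$. A triple line on $X$ is a line $\ell\subset X$ of the second type with $\ell'=\ell$, i.e. $P\cap X$ is the plane cubic $3\ell$. *)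

theory Defs
  imports "HOL-Analysis.Analysis"
begin

text \<open>
  Projective 4-space over the complex numbers is handled through homogeneous coordinates in
  \<^typ>\<open>complex ^ 5\<close>. A point is given by a nonzero vector (every notion below is invariant under
  rescaling it), a linear subspace of projective dimension \<open>k\<close> by the complex linear subspace of
  dimension \<open>k + 1\<close> lying over it, and a hypersurface by a form \<open>F\<close>, its point set being the
  cone \<open>zero_locus F\<close>. As the ground field is infinite, forms are identified with polynomial
  functions.
\<close>

definition proj_subspace :: "nat \<Rightarrow> (complex ^ 5) set \<Rightarrow> bool" where
  "proj_subspace k V \<longleftrightarrow> vec.subspace V \<and> vec.dim V = k + 1"

abbreviation proj_line :: "(complex ^ 5) set \<Rightarrow> bool" where
  "proj_line \<equiv> proj_subspace 1"

abbreviation proj_plane :: "(complex ^ 5) set \<Rightarrow> bool" where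
  "proj_plane \<equiv> proj_subspace 2"

definition linear_form :: "(complex ^ 5 \<Rightarrow> complex) \<Rightarrow> bool" where
  "linear_form L \<longleftrightarrow> Vector_Spaces.linear (*s) (*) L"

definition cubic_form :: "(complex ^ 5 \<Rightarrow> complex) \<Rightarrow> bool" where
  "cubic_form F \<longleftrightarrow>
     (\<exists>c :: 5 \<Rightarrow> 5 \<Rightarrow> 5 \<Rightarrow> complex.
        \<forall>x. F x = (\<Sum>i\<in>UNIV. \<Sum>j\<in>UNIV. \<Sum>k\<in>UNIV. c i j k * x $ i * x $ j * x $ k))"

definition zero_locus :: "(complex ^ 5 \<Rightarrow> complex) \<Rightarrow> (complex ^ 5) set" where
  "zero_locus F = {x. F x = 0}"

definition partial_deriv :: "(complex ^ 5 \<Rightarrow> complex) \<Rightarrow> 5 \<Rightarrow> complex ^ 5 \<Rightarrow> complex" where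
  "partial_deriv F i x = deriv (\<lambda>t. F (x + t *s axis i 1)) 0"

definition smooth_cubic_threefold :: "(complex ^ 5 \<Rightarrow> complex) \<Rightarrow> bool" where
  "smooth_cubic_threefold F \<longleftrightarrow>
     cubic_form F \<and> (\<exists>x. F x \<noteq> 0) \<and>
     (\<forall>x. x \<noteq> 0 \<and> x \<in> zero_locus F \<longrightarrow> (\<exists>i. partial_deriv F i x \<noteq> 0))"

definition tangent_space :: "(complex ^ 5 \<Rightarrow> complex) \<Rightarrow> complex ^ 5 \<Rightarrow> (complex ^ 5) set" where
  "tangent_space F x = {w. (\<Sum>i\<in>UNIV. partial_deriv F i x * w $ i) = 0}"

text \<open>The part of degree \<open>d\<close> of the Taylor expansion of \<open>F (x + w)\<close> in powers of \<open>w\<close>.\<close>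

definition taylor_part ::
  "(complex ^ 5 \<Rightarrow> complex) \<Rightarrow> complex ^ 5 \<Rightarrow> nat \<Rightarrow> complex ^ 5 \<Rightarrow> complex" where
  "taylor_part F x d w = (deriv ^^ d) (\<lambda>t. F (x + t *s w)) 0 / fact d"

text \<open>
  The multiplicity at the point \<open>x\<close> of the hypersurface cut out by \<open>F\<close> in the linear subspace
  \<open>H\<close> (containing \<open>x\<close>) is the degree of the lowest nonzero part of a local equation. The local
  equation is \<open>w \<mapsto> F (x + w)\<close> in the affine chart of \<open>H\<close> where coordinate \<open>i\<close> is constantly
  \<open>x $ i\<close>, for an \<open>i\<close> with \<open>x $ i \<noteq> 0\<close>; the multiplicity does not depend on \<open>i\<close>.
\<close>

definition has_multiplicity ::
  "(complex ^ 5 \<Rightarrow> complex) \<Rightarrow> (complex ^ 5) set \<Rightarrow> complex ^ 5 \<Rightarrow> nat \<Rightarrow> bool" where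
  "has_multiplicity F H x m \<longleftrightarrow>
     (\<exists>i. x $ i \<noteq> 0 \<and>
        (\<forall>d<m. \<forall>w\<in>H. w $ i = 0 \<longrightarrow> taylor_part F x d w = 0) \<and>
        (\<exists>w\<in>H. w $ i = 0 \<and> taylor_part F x m w \<noteq> 0))"

definition eckardt_point :: "(complex ^ 5 \<Rightarrow> complex) \<Rightarrow> complex ^ 5 \<Rightarrow> bool" where
  "eckardt_point F p \<longleftrightarrow>
     p \<noteq> 0 \<and> p \<in> zero_locus F \<and> has_multiplicity F (tangent_space F p) p 3"

definition tangent_plane_along ::
  "(complex ^ 5 \<Rightarrow> complex) \<Rightarrow> (complex ^ 5) set \<Rightarrow> (complex ^ 5) set \<Rightarrow> bool" where
  "tangent_plane_along F l P \<longleftrightarrow>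
     proj_plane P \<and> l \<subseteq> P \<and> (\<forall>x\<in>l. x \<noteq> 0 \<longrightarrow> P \<subseteq> tangent_space F x)"

definition line_of_second_type :: "(complex ^ 5 \<Rightarrow> complex) \<Rightarrow> (complex ^ 5) set \<Rightarrow> bool" where
  "line_of_second_type F l \<longleftrightarrow>
     proj_line l \<and> l \<subseteq> zero_locus F \<and> (\<exists>!P. tangent_plane_along F l P)"

text \<open>
  Equality of plane cubics (with multiplicities) in \<open>P\<close>: the curve cut out by \<open>F\<close> is
  \<open>2 l \<union> l'\<close>, that is, the restriction of \<open>F\<close> to \<open>P\<close> is the square of an equation of \<open>l\<close>
  times an equation of \<open>l'\<close>; constant factors are absorbed in the equations.
\<close>

definition plane_section_eq ::
  "(complex ^ 5 \<Rightarrow> complex) \<Rightarrow> (complex ^ 5) set \<Rightarrow> (complex ^ 5) set \<Rightarrow> (complex ^ 5) set \<Rightarrow> bool"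
  where
  "plane_section_eq F P l l' \<longleftrightarrow>
     (\<exists>L L'. linear_form L \<and> linear_form L' \<and>
        {x\<in>P. L x = 0} = l \<and> {x\<in>P. L' x = 0} = l' \<and>
        (\<forall>x\<in>P. F x = (L x)\<^sup>2 * L' x))"

definition residual_line ::
  "(complex ^ 5 \<Rightarrow> complex) \<Rightarrow> (complex ^ 5) set \<Rightarrow> (complex ^ 5) set \<Rightarrow> bool" where
  "residual_line F l l' \<longleftrightarrow>
     proj_line l' \<and> (\<exists>P. tangent_plane_along F l P \<and> plane_section_eq F P l l')"

definition triple_line :: "(complex ^ 5 \<Rightarrow> complex) \<Rightarrow> (complex ^ 5) set \<Rightarrow> bool" where
  "triple_line F l \<longleftrightarrow> line_of_second_type F l \<and> residual_line F l l"

end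

theory Submission
  imports Defs
begin

text \<open>
  In the coordinates \<open>(x, y, z, u, v)\<close> the threefold is
  \<open>x\<^sup>2 u + u\<^sup>2 y + y\<^sup>2 v + v\<^sup>2 x + z\<^sup>2 u + z\<^sup>3 = 0\<close>.

  The terms other than \<open>z\<^sup>3\<close> lie in the ideal \<open>(u, v)\<close>, so the plane \<open>u = v = 0\<close> cuts out
  \<open>z\<^sup>3 = 0\<close>, three times the line \<open>z = u = v = 0\<close>. Along this line the differential is
  \<open>x\<^sup>2 du + y\<^sup>2 dv\<close>; as \<open>x\<^sup>2\<close> and \<open>y\<^sup>2\<close> are linearly independent, a plane tangent along the line
  must lie in \<open>u = v = 0\<close>. Hence the line is a triple line (lemma \<open>triple_line_cubic\<close>).

  If \<open>p\<close> is an Eckardt point, the quadratic form given by half the Hessian at \<open>p\<close> vanishes on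
  the tangent hyperplane, so it is a product of two linear forms and its matrix has rank at most
  two: all its minors of size three vanish (lemmas \<open>minor_vanishes\<close> and
  \<open>eckardt_minor_vanishes\<close>). The matrix is sparse with linear entries, and a few of its minors
  already force \<open>x = y = u = v = 0\<close>; the remaining point \<open>(0, 0, 1, 0, 0)\<close> is not on the
  threefold.

  The first four terms form a cyclic cubic surface, which by itself has many symmetries, some of
  them reflections, and hence Eckardt points. The term \<open>z\<^sup>2 u\<close> is there to destroy these.
\<close>

section \<open>Symmetric bilinear forms vanishing on a hyperplane\<close>

text \<open>
  With \<open>a = B p\<close> and \<open>a k \<noteq> 0\<close>, the vectors \<open>a(k) e - a(e) k\<close> lie in the kernel of \<open>a\<close>, on which
  \<open>B\<close> vanishes by polarisation. Solving for \<open>B e f\<close> gives \<open>a(e) b(f) + b(e) a(f)\<close>, where \<open>b\<close>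
  is a linear form: \<open>B\<close> has rank at most two.
\<close>
lemma bilinear_product_of_linear_forms:
  fixes B :: "complex ^ 'n \<Rightarrow> complex ^ 'n \<Rightarrow> complex"
  assumes add: "\<And>x y w. B (x + y) w = B x w + B y w"
    and scale: "\<And>c x w. B (c *s x) w = c * B x w"
    and sym: "\<And>x y. B x y = B y x"
    and k: "B p k \<noteq> 0"
    and isotropic: "\<And>w. B p w = 0 \<Longrightarrow> B w w = 0"
  obtains b where "\<And>e f. B e f = B p e * b f + b e * B p f"
proof -
  have add': "B w (x + y) = B w x + B w y" for x y w
    by (metis add sym)
  have scale': "B w (c *s x) = c * B w x" for c x w
    by (metis scale sym)
  have polar: "B w w' = 0" if "B p w = 0" "B p w' = 0" for w w'
  proof -
    have "B (w + w') (w + w') = 0"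
      by (rule isotropic) (simp add: add' that)
    moreover have "B w w = 0" "B w' w' = 0"
      using that isotropic by auto
    ultimately show ?thesis
      using sym[of w' w] by (simp add: add add')
  qed
  define b where "b e = B e k / B p k - B p e * B k k / (2 * (B p k)\<^sup>2)" for e
  have "B e f = B p e * b f + b e * B p f" for e f
  proof -
    have "B (B p k *s e + (- B p e) *s k) (B p k *s f + (- B p f) *s k) = 0"
      by (rule polar) (simp_all only: add' scale', simp_all)
    then have "(B p k)\<^sup>2 * B e f
      = B p k * B p f * B e k + B p e * B p k * B f k - B p e * B p f * B k k"
      using sym[of k f]
      by (simp only: add add' scale scale') (simp add: algebra_simps power2_eq_square)
    moreover have b: "(B p k)\<^sup>2 * b e = B p k * B e k - B p e * B k k / 2" for e
      using k by (simp add: b_def field_simps power2_eq_square)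
    have "(B p k)\<^sup>2 * (B p e * b f + b e * B p f)
      = B p e * ((B p k)\<^sup>2 * b f) + ((B p k)\<^sup>2 * b e) * B p f"
      by (simp add: algebra_simps)
    then have "(B p k)\<^sup>2 * (B p e * b f + b e * B p f)
      = B p k * B p f * B e k + B p e * B p k * B f k - B p e * B p f * B k k"
      unfolding b by (simp add: algebra_simps)
    ultimately have "(B p k)\<^sup>2 * B e f = (B p k)\<^sup>2 * (B p e * b f + b e * B p f)"
      by simp
    then show ?thesis
      using k by simp
  qed
  then show ?thesis
    by (rule that)
qed

definition minor3 :: "('a \<Rightarrow> 'b \<Rightarrow> complex) \<Rightarrow> 'a \<Rightarrow> 'a \<Rightarrow> 'a \<Rightarrow> 'b \<Rightarrow> 'b \<Rightarrow> 'b \<Rightarrow> complex" where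
  "minor3 M i j k l m n =
     M i l * (M j m * M k n - M j n * M k m)
   - M i m * (M j l * M k n - M j n * M k l)
   + M i n * (M j l * M k m - M j m * M k l)"

lemma minor_vanishes:
  fixes B :: "complex ^ 'n \<Rightarrow> complex ^ 'n \<Rightarrow> complex"
  assumes "\<And>x y w. B (x + y) w = B x w + B y w"
    and "\<And>c x w. B (c *s x) w = c * B x w"
    and "\<And>x y. B x y = B y x"
    and "B p k \<noteq> 0"
    and "\<And>w. B p w = 0 \<Longrightarrow> B w w = 0"
  shows "minor3 B e e' e'' f f' f'' = 0"
proof -
  obtain b where "\<And>e f. B e f = B p e * b f + b e * B p f"
    using bilinear_product_of_linear_forms[of B p k] assms by blast
  then obtain a where B: "\<And>e f. B e f = a e * b f + b e * a f"
    by blast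
  show ?thesis
    unfolding minor3_def B by (simp add: algebra_simps)
qed

section \<open>The cubic form and its Taylor expansion\<close>

lemma exhaust_5:
  fixes x :: 5
  shows "x = 1 \<or> x = 2 \<or> x = 3 \<or> x = 4 \<or> x = 5"
proof (induct x)
  case (of_int z)
  then have "z = 0 \<or> z = 1 \<or> z = 2 \<or> z = 3 \<or> z = 4"
    by fastforce
  then show ?case
    by auto
qed

lemma forall_5: "(\<forall>i::5. P i) \<longleftrightarrow> P 1 \<and> P 2 \<and> P 3 \<and> P 4 \<and> P 5"
  by (metis exhaust_5)

lemma UNIV_5: "UNIV = {1, 2, 3, 4, 5 :: 5}"
  using exhaust_5 by auto

lemma sum_5: "sum f (UNIV :: 5 set) = f 1 + f 2 + f 3 + f 4 + f 5"
  unfolding UNIV_5 by (simp add: ac_simps)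

lemma cubic_form_monomial: "cubic_form (\<lambda>x. x $ l * x $ m * x $ n)"
  unfolding cubic_form_def
proof (intro exI allI)
  have pull: "(\<Sum>i\<in>UNIV. if Q then f i else 0) = (if Q then \<Sum>i\<in>UNIV. f i else 0)"
    for Q and f :: "5 \<Rightarrow> complex"
    by simp
  fix x :: "complex ^ 5"
  show "x $ l * x $ m * x $ n = (\<Sum>i\<in>UNIV. \<Sum>j\<in>UNIV. \<Sum>k\<in>UNIV.
      (if i = l then if j = m then if k = n then 1 else 0 else 0 else 0)
        * x $ i * x $ j * x $ k)"
    by (simp add: if_distrib[where f = "\<lambda>c. c * _"] pull cong: if_cong)
qed

lemma cubic_form_add:
  assumes "cubic_form F" "cubic_form G"
  shows "cubic_form (\<lambda>x. F x + G x)"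
proof -
  obtain c d where
    "\<And>x. F x = (\<Sum>i\<in>UNIV. \<Sum>j\<in>UNIV. \<Sum>k\<in>UNIV. c i j k * x $ i * x $ j * x $ k)"
    "\<And>x. G x = (\<Sum>i\<in>UNIV. \<Sum>j\<in>UNIV. \<Sum>k\<in>UNIV. d i j k * x $ i * x $ j * x $ k)"
    using assms unfolding cubic_form_def by blast
  then show ?thesis
    unfolding cubic_form_def
    by (intro exI[where x = "\<lambda>i j k. c i j k + d i j k"])
      (simp add: sum.distrib algebra_simps)
qed

text \<open>The coordinates \<open>x, y, z, u, v\<close> are numbered \<open>1, 2, 3, 4, 5\<close>.\<close>

definition cubic :: "complex ^ 5 \<Rightarrow> complex" where
  "cubic p = p$1 * p$1 * p$4 + p$4 * p$4 * p$2 + p$2 * p$2 * p$5 + p$5 * p$5 * p$1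
     + p$3 * p$3 * p$4 + p$3 * p$3 * p$3"

text \<open>
  Three times the symmetric trilinear form whose diagonal is \<^const>\<open>cubic\<close>. Thus \<open>polar p\<close> has
  half the Hessian matrix at \<open>p\<close>, and by Euler's formula \<open>polar p p\<close> is the differential at \<open>p\<close>.
\<close>
definition polar :: "complex ^ 5 \<Rightarrow> complex ^ 5 \<Rightarrow> complex ^ 5 \<Rightarrow> complex" where
  "polar p w w' =
     p$4 * w$1 * w'$1 + p$1 * (w$1 * w'$4 + w$4 * w'$1)
   + p$2 * w$4 * w'$4 + p$4 * (w$4 * w'$2 + w$2 * w'$4)
   + p$5 * w$2 * w'$2 + p$2 * (w$2 * w'$5 + w$5 * w'$2)
   + p$1 * w$5 * w'$5 + p$5 * (w$5 * w'$1 + w$1 * w'$5)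
   + p$4 * w$3 * w'$3 + p$3 * (w$3 * w'$4 + w$4 * w'$3)
   + 3 * p$3 * w$3 * w'$3"

lemma polar_add: "polar p (x + y) w = polar p x w + polar p y w"
  by (simp add: polar_def algebra_simps)

lemma polar_scale: "polar p (c *s x) w = c * polar p x w"
  by (simp add: polar_def algebra_simps)

lemma polar_sym: "polar p x y = polar p y x"
  by (simp add: polar_def algebra_simps)

lemma polar_self: "polar p p p = 3 * cubic p"
  by (simp add: polar_def cubic_def algebra_simps)

lemma cubic_expansion:
  "cubic (p + t *s w) = cubic p + polar p p w * t + polar p w w * t ^ 2 + cubic w * t ^ 3"
  by (simp add: cubic_def polar_def algebra_simps power2_eq_square power3_eq_cube)

lemma deriv_cubic_poly:
  "deriv (\<lambda>t::complex. a + b * t + c * t ^ 2 + d * t ^ 3)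
    = (\<lambda>t. b + (2 * c) * t + (3 * d) * t ^ 2)"
proof
  fix t
  have "((\<lambda>t::complex. a + b * t + c * t ^ 2 + d * t ^ 3)
      has_field_derivative b + (2 * c) * t + (3 * d) * t ^ 2) (at t)"
    by (rule derivative_eq_intros refl)+ simp
  then show "deriv (\<lambda>t. a + b * t + c * t ^ 2 + d * t ^ 3) t
      = b + (2 * c) * t + (3 * d) * t ^ 2"
    by (rule DERIV_imp_deriv)
qed

lemma partial_deriv_cubic: "partial_deriv cubic i p = polar p p (axis i 1)"
  by (simp add: partial_deriv_def cubic_expansion deriv_cubic_poly)

lemma taylor_part_2_cubic: "taylor_part cubic p 2 w = polar p w w"
proof -
  have deriv2: "(deriv ^^ 2) f = deriv (deriv f)" for f :: "complex \<Rightarrow> complex"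
    by (simp add: numeral_2_eq_2)
  have "deriv (\<lambda>t. b + c * t + d * t ^ 2) = (\<lambda>t. c + 2 * d * t)" for b c d :: complex
    using deriv_cubic_poly[of b c d 0] by simp
  then show ?thesis
    unfolding taylor_part_def cubic_expansion deriv2 deriv_cubic_poly by simp
qed

lemma tangent_space_cubic: "tangent_space cubic p = {w. polar p p w = 0}"
  by (simp add: tangent_space_def partial_deriv_cubic sum_5 polar_def axis_def algebra_simps)

section \<open>Smoothness\<close>

text \<open>
  The equations are the vanishing of the five partial derivatives. The derivative by \<open>z\<close> is
  \<open>z (2 u + 3 z)\<close>. If \<open>z = 0\<close>, cyclic elimination gives \<open>v\<^sup>4 = 16 v\<^sup>4\<close>. If \<open>3 z = - 2 u \<noteq> 0\<close>, it
  gives \<open>u\<^sup>5 = 4 v\<^sup>5\<close> and \<open>16 u\<^sup>4 = 135 v\<^sup>4\<close>, which are incompatible.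
\<close>
lemma critical_point_zero:
  fixes x y z u v :: complex
  assumes x: "2 * x * u + v\<^sup>2 = 0"
    and y: "u\<^sup>2 + 2 * y * v = 0"
    and z: "2 * z * u + 3 * z\<^sup>2 = 0"
    and u: "x\<^sup>2 + 2 * u * y + z\<^sup>2 = 0"
    and v: "y\<^sup>2 + 2 * x * v = 0"
  shows "x = 0 \<and> y = 0 \<and> z = 0 \<and> u = 0 \<and> v = 0"
proof -
  have xu: "2 * x * u = - v\<^sup>2" and uu: "u\<^sup>2 = - 2 * y * v" and yy: "y\<^sup>2 = - 2 * x * v"
    using x y v by (simp_all add: eq_neg_iff_add_eq_0)
  have v4: "v ^ 4 = 4 * x\<^sup>2 * u\<^sup>2"
  proof -
    have "v ^ 4 = (2 * x * u)\<^sup>2"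
      unfolding xu by (simp flip: power_mult)
    then show ?thesis
      by (simp add: power_mult_distrib)
  qed
  have uvy: "u * v * y\<^sup>2 = v ^ 4"
  proof -
    have "u * v * y\<^sup>2 = - (2 * x * u) * v\<^sup>2"
      unfolding yy by (simp add: power2_eq_square)
    then show ?thesis
      unfolding xu by (simp flip: power_add)
  qed
  show ?thesis
  proof (cases "z = 0")
    case True
    then have xx: "x\<^sup>2 = - 2 * u * y"
      using u by (simp add: eq_neg_iff_add_eq_0)
    have "v ^ 4 = 16 * (u * v * y\<^sup>2)"
      unfolding v4 xx uu by (simp add: power2_eq_square)
    then have "v = 0"
      unfolding uvy by simp
    with x y u v True show ?thesis
      by simp
  next
    case False
    have "z * (2 * u + 3 * z) = 0"
      using z by (simp add: algebra_simps power2_eq_square)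
    then have zu: "3 * z = - 2 * u"
      using False by (simp add: eq_neg_iff_add_eq_0 add.commute)
    then have "u \<noteq> 0"
      using False by auto
    have "u ^ 5 = (u\<^sup>2)\<^sup>2 * u"
      by (simp flip: power_mult power_Suc2)
    also have "\<dots> = 4 * v\<^sup>2 * y\<^sup>2 * u"
      unfolding uu by (simp add: power2_eq_square)
    also have "\<dots> = 4 * v * (u * v * y\<^sup>2)"
      by (simp add: power2_eq_square)
    also have "\<dots> = 4 * v ^ 5"
      unfolding uvy by (simp flip: power_Suc)
    finally have u5: "u ^ 5 = 4 * v ^ 5" .
    have xx: "9 * x\<^sup>2 = - 18 * u * y - 4 * u\<^sup>2"
    proof -
      have "9 * z\<^sup>2 = (3 * z)\<^sup>2"
        by (simp add: power_mult_distrib)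
      then have "9 * z\<^sup>2 = 4 * u\<^sup>2"
        unfolding zu by (simp add: power_mult_distrib)
      moreover have "9 * x\<^sup>2 + 18 * u * y + 9 * z\<^sup>2 = 9 * (x\<^sup>2 + 2 * u * y + z\<^sup>2)"
        by (simp add: algebra_simps)
      ultimately show ?thesis
        unfolding u by (simp add: eq_diff_eq eq_neg_iff_add_eq_0 algebra_simps)
    qed
    have "9 * v ^ 4 = 4 * (9 * x\<^sup>2) * u\<^sup>2"
      unfolding v4 by simp
    also have "\<dots> = - 72 * (u * y * u\<^sup>2) - 16 * u ^ 4"
      unfolding xx by (simp add: algebra_simps power2_eq_square power4_eq_xxxx)
    also have "u * y * u\<^sup>2 = - 2 * v ^ 4"
      unfolding uvy[symmetric] uu by (simp add: power2_eq_square)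
    finally have u4: "16 * u ^ 4 = 135 * v ^ 4"
      by (simp add: algebra_simps)
    have "v \<noteq> 0"
      using u5 \<open>u \<noteq> 0\<close> by auto
    have "u * (135 * v ^ 4) = 16 * u ^ 5"
      unfolding u4[symmetric] by (simp flip: power_Suc)
    also have "\<dots> = 64 * v * v ^ 4"
      unfolding u5 by (simp flip: power_Suc)
    finally have "u = 64 / 135 * v"
      using \<open>v \<noteq> 0\<close> by (simp add: field_simps)
    with u4 \<open>v \<noteq> 0\<close> show ?thesis
      by (simp add: power_mult_distrib power_divide)
  qed
qed

lemma cubic_critical_point:
  assumes "\<And>i. partial_deriv cubic i p = 0"
  shows "p = 0"
proof -
  have "2 * p$1 * p$4 + (p$5)\<^sup>2 = 0" "(p$4)\<^sup>2 + 2 * p$2 * p$5 = 0"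
    "2 * p$3 * p$4 + 3 * (p$3)\<^sup>2 = 0" "(p$1)\<^sup>2 + 2 * p$4 * p$2 + (p$3)\<^sup>2 = 0"
    "(p$2)\<^sup>2 + 2 * p$1 * p$5 = 0"
    using assms[of 1] assms[of 2] assms[of 3] assms[of 4] assms[of 5]
    by (simp_all add: partial_deriv_cubic polar_def axis_def algebra_simps power2_eq_square)
  from critical_point_zero[OF this] show ?thesis
    by (simp add: vec_eq_iff forall_5)
qed

lemma smooth_cubic_threefold_cubic: "smooth_cubic_threefold cubic"
proof -
  have "cubic_form (\<lambda>p. cubic p)"
    unfolding cubic_def by (intro cubic_form_add cubic_form_monomial)
  moreover have "cubic (axis 3 1) \<noteq> 0"
    by (simp add: cubic_def axis_def)
  ultimately show ?thesis
    unfolding smooth_cubic_threefold_def using cubic_critical_point by blast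
qed

section \<open>Absence of Eckardt points\<close>

lemma eckardt_minor_vanishes:
  assumes "eckardt_point cubic p"
  shows "minor3 (polar p) e e' e'' f f' f'' = 0"
proof -
  have "p \<noteq> 0" and F: "cubic p = 0"
    using assms by (auto simp: eckardt_point_def zero_locus_def)
  obtain i where i: "p $ i \<noteq> 0"
    and chart: "\<And>w. polar p p w = 0 \<Longrightarrow> w $ i = 0 \<Longrightarrow> polar p w w = 0"
    using assms
    by (fastforce simp: eckardt_point_def has_multiplicity_def tangent_space_cubic
        taylor_part_2_cubic[symmetric])
  \<comment> \<open>The point \<open>p\<close> lies in the radical of the form on the tangent space, so tangent vectors may be
    moved into the chart by subtracting a multiple of \<open>p\<close>.\<close>
  have isotropic: "polar p w w = 0" if w: "polar p p w = 0" for w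
  proof -
    define c where "c = - (w $ i / p $ i)"
    have pp: "polar p p p = 0"
      using F by (simp add: polar_self)
    have add': "polar p q (w + c *s p) = polar p q w + c * polar p q p" for q
      by (metis polar_add polar_scale polar_sym)
    have wp: "polar p w p = 0"
      using w by (metis polar_sym)
    have "polar p (w + c *s p) (w + c *s p) = 0"
    proof (rule chart)
      show "polar p p (w + c *s p) = 0"
        unfolding add' using w pp by simp
      show "(w + c *s p) $ i = 0"
        using i by (simp add: c_def)
    qed
    then show ?thesis
      unfolding add' polar_add polar_scale using w wp pp by simp
  qed
  obtain k where k: "polar p p (axis k 1) \<noteq> 0"
    using cubic_critical_point[of p] \<open>p \<noteq> 0\<close> by (auto simp: partial_deriv_cubic)
  show ?thesis
    by (rule minor_vanishes[OF polar_add polar_scale polar_sym k isotropic])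
qed

lemma no_eckardt_point_cubic: "\<not> eckardt_point cubic p"
proof
  assume p: "eckardt_point cubic p"
  define x y z u v where "x = p$1" and "y = p$2" and "z = p$3" and "u = p$4" and "v = p$5"
  note coords = x_def y_def z_def u_def v_def
  define m where "m i j k l m' n = minor3 (polar p) (axis i 1) (axis j 1) (axis k 1)
    (axis l 1) (axis m' 1) (axis n 1)" for i j k l m' n :: 5
  have m: "m i j k l m' n = 0" for i j k l m' n
    unfolding m_def by (rule eckardt_minor_vanishes[OF p])
  note minor = m_def minor3_def polar_def axis_def coords[symmetric]
  have "x = 0 \<and> y = 0 \<and> u = 0 \<and> v = 0"
  proof (cases "3 * z + u = 0")
    case True
    have "z\<^sup>2 * u = (3 * z + u) * (u * y - x\<^sup>2)"
      using m[of 1 4 3 1 4 3] by (simp add: minor algebra_simps power2_eq_square)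
    then have "z\<^sup>2 * u = 0"
      unfolding True by simp
    then have "z = 0" "u = 0"
      using True by auto
    have *: "x * x * v = 0" "x * x * y = 0"
      using m[of 1 4 2 1 4 2] m[of 1 4 2 1 4 5] \<open>z = 0\<close> \<open>u = 0\<close> by (simp_all add: minor)
    have "x = 0"
      using m[of 1 4 5 1 4 5] * \<open>z = 0\<close> \<open>u = 0\<close> by (auto simp: minor)
    moreover have "v = 0"
      using m[of 1 2 5 1 2 5] \<open>z = 0\<close> \<open>u = 0\<close> \<open>x = 0\<close> by (auto simp: minor)
    moreover have "y = 0"
      using m[of 4 2 5 4 2 5] \<open>z = 0\<close> \<open>u = 0\<close> \<open>x = 0\<close> \<open>v = 0\<close> by (auto simp: minor)
    ultimately show ?thesis
      using \<open>u = 0\<close> by simp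
  next
    case False
    then have nz: "u + 3 * z \<noteq> 0"
      by (simp add: add.commute)
    \<comment> \<open>Expanding along the row of \<open>z\<close> gives the minors of size two in the rows of \<open>x, y, v\<close>.\<close>
    have "v * v * (u + 3 * z) = 0"
      using m[of 1 2 3 5 2 3] by (simp add: minor algebra_simps)
    then have "v = 0"
      using nz by simp
    have "y * y * (u + 3 * z) = 0"
      using m[of 2 5 3 5 2 3] \<open>v = 0\<close> by (simp add: minor algebra_simps)
    then have "y = 0"
      using nz by simp
    have "u = 0"
      using m[of 1 4 2 1 4 2] \<open>v = 0\<close> \<open>y = 0\<close> by (auto simp: minor)
    moreover have "x = 0"
      using m[of 1 4 5 1 4 5] \<open>u = 0\<close> \<open>v = 0\<close> \<open>y = 0\<close> by (auto simp: minor)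
    ultimately show ?thesis
      using \<open>v = 0\<close> \<open>y = 0\<close> by simp
  qed
  moreover have "p \<noteq> 0" "cubic p = 0"
    using p by (auto simp: eckardt_point_def zero_locus_def)
  ultimately show False
    by (auto simp: cubic_def vec_eq_iff forall_5 coords)
qed

section \<open>A triple line\<close>

lemma proj_subspace_coordinates:
  fixes d :: "5 set"
  assumes "card d = k + 1"
  shows "proj_subspace k {w. \<forall>i. i \<notin> d \<longrightarrow> w $ i = 0}"
  using assms
  by (auto simp: proj_subspace_def dim_substandard_cart vec.subspace_def)

lemma linear_form_coordinate: "linear_form (\<lambda>w. w $ i)"
  unfolding linear_form_def
  by (rule Vector_Spaces.linear_iff[THEN iffD2])
    (auto simp: vec.vector_space_axioms vector_space_over_itself.vector_space_axioms)

lemma triple_line_cubic: "triple_line cubic {w. w$3 = 0 \<and> w$4 = 0 \<and> w$5 = 0}"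
proof -
  define l where "l = {w :: complex ^ 5. w$3 = 0 \<and> w$4 = 0 \<and> w$5 = 0}"
  define P where "P = {w :: complex ^ 5. w$4 = 0 \<and> w$5 = 0}"
  have l: "proj_line l"
    using proj_subspace_coordinates[of "{1, 2}" 1] by (simp add: l_def forall_5)
  have P: "proj_plane P"
    using proj_subspace_coordinates[of "{1, 2, 3}" 2] by (simp add: P_def forall_5)
  have tangent: "tangent_plane_along cubic l P"
    unfolding tangent_plane_along_def tangent_space_cubic
    using P by (auto simp: l_def P_def polar_def)
  have unique: "P' = P" if P': "tangent_plane_along cubic l P'" for P'
  proof -
    have "w \<in> P" if "w \<in> P'" for w
    proof -
      have "polar e e w = 0" if "e \<in> l" "e \<noteq> 0" for e
        using P' \<open>w \<in> P'\<close> that unfolding tangent_plane_along_def tangent_space_cubic by blast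
      from this[of "axis 1 1"] this[of "axis 2 1"] show ?thesis
        by (simp add: l_def P_def polar_def axis_def vec_eq_iff forall_5)
    qed
    then have "P' \<subseteq> P"
      by blast
    then show ?thesis
      using P P' unfolding tangent_plane_along_def proj_subspace_def
      by (intro vec.subspace_dim_equal) auto
  qed
  have "plane_section_eq cubic P l l"
    unfolding plane_section_eq_def
    by (intro exI[where x = "\<lambda>w. w $ 3"] conjI linear_form_coordinate)
      (auto simp: l_def P_def cubic_def power2_eq_square)
  then have "residual_line cubic l l"
    using l tangent unfolding residual_line_def by blast
  moreover have "line_of_second_type cubic l"
    unfolding line_of_second_type_def using l tangent unique
    by (auto simp: zero_locus_def l_def cubic_def)
  ultimately show ?thesis
    unfolding triple_line_def l_def by blast
qed

theorem mainTheorem1: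
  shows "\<exists>F :: complex ^ 5 \<Rightarrow> complex.
           smooth_cubic_threefold F \<and>
           (\<nexists>p. eckardt_point F p) \<and>
           (\<exists>l. triple_line F l)"
  using smooth_cubic_threefold_cubic no_eckardt_point_cubic triple_line_cubic by blast

end
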